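(* There exists $P_0$ such that for every real $P \ge P_0$ there is a $K_5$-free graph $G$ with $\rho(G) \le P$ and $\chi_f(G) > P^2/82$.
   Context: Graphs are finite and simple. A graph is $K_5$-free if it contains no complete graph on $5$ vertices as a subgraph. For a graph $G$, $v(G)$ is its number of vertices and $\alpha(G)$ is the size of a largest independent set. The Hall ratio of $G$ is $\rho(G) := \max_{\emptyset\neq H\subseteq G} \frac{v(H)}{\alpha(H)}$, the maximum over all subgraphs $H$ of $G$ with at least one vertex. The fractional chromatic number $\chi_f(G)$ is the optimal value of the linear program: minimize $\sum_{I} x_I$ over nonnegative reals $x_I$ indexed by the independent sets $I$ of $G$, subject to $\sum_{I\ni v} x_I\ge 1$ for every vertex $v$. Equivalently, by LP duality, it is the maximum of $\sum_{v\in V(G)} y(v)$ over $y:V(G)\to[0,\infty)$ with $\sum_{v\in I} y(v)\le 1$ for every independent set $I$ of $G$. *)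

theory Defs
  imports Complex_Main "HOL-Library.Ramsey"
begin

text \<open>Graphs are pairs of a vertex set and a set of edges, each edge being a two-element
  set of vertices.\<close>

type_synonym 'a graph = "'a set \<times> 'a set set"

abbreviation verts :: "'a graph \<Rightarrow> 'a set" where
  "verts G \<equiv> fst G"

abbreviation edges :: "'a graph \<Rightarrow> 'a set set" where
  "edges G \<equiv> snd G"

definition simple_graph :: "'a graph \<Rightarrow> bool" where
  "simple_graph G \<longleftrightarrow> finite (verts G) \<and> edges G \<subseteq> [verts G]\<^bsup>2\<^esup>"

definition subgraph :: "'a graph \<Rightarrow> 'a graph \<Rightarrow> bool" where
  "subgraph H G \<longleftrightarrow> simple_graph H \<and> verts H \<subseteq> verts G \<and> edges H \<subseteq> edges G"

definition complete_graph :: "nat \<Rightarrow> 'a graph \<Rightarrow> bool" where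
  "complete_graph n K \<longleftrightarrow> simple_graph K \<and> card (verts K) = n \<and> clique (verts K) (edges K)"

definition complete_free :: "nat \<Rightarrow> 'a graph \<Rightarrow> bool" where
  "complete_free n G \<longleftrightarrow> \<not> (\<exists>K. subgraph K G \<and> complete_graph n K)"

definition independent_sets :: "'a graph \<Rightarrow> 'a set set" where
  "independent_sets G = {I. I \<subseteq> verts G \<and> indep I (edges G)}"

definition independence_number :: "'a graph \<Rightarrow> nat" where
  "independence_number G = Max (card ` independent_sets G)"

text \<open>For a graph without vertices the maximum is over the empty set, so the value is
  unspecified.\<close>

definition hall_ratio :: "'a graph \<Rightarrow> real" where
  "hall_ratio G =
    Max {real (card (verts H)) / real (independence_number H) | H. subgraph H G \<and> verts H \<noteq> {}}"

text \<open>The values of a weighting outside the independent sets are irrelevant. The empty set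
  counts as independent; its weight occurs in no constraint and can only increase the
  objective.\<close>

definition fractional_colouring :: "'a graph \<Rightarrow> ('a set \<Rightarrow> real) \<Rightarrow> bool" where
  "fractional_colouring G x \<longleftrightarrow>
    (\<forall>I\<in>independent_sets G. 0 \<le> x I) \<and>
    (\<forall>v\<in>verts G. 1 \<le> (\<Sum>I | I \<in> independent_sets G \<and> v \<in> I. x I))"

definition fractional_chromatic_number :: "'a graph \<Rightarrow> real" where
  "fractional_chromatic_number G =
    Inf {\<Sum>I\<in>independent_sets G. x I | x. fractional_colouring G x}"

text \<open>The maxima, the sums and the infimum above are over finite, respectively nonempty and
  bounded below, sets.\<close>

lemma finite_independent_sets: "simple_graph G \<Longrightarrow> finite (independent_sets G)"
  by (rule finite_subset[of _ "Pow (verts G)"]) (auto simp: independent_sets_def simple_graph_def)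

lemma independent_sets_nonempty: "independent_sets G \<noteq> {}"
  unfolding independent_sets_def using null_indep by blast

lemma finite_subgraphs:
  assumes "simple_graph G"
  shows "finite {H. subgraph H G}"
proof (rule finite_subset)
  show "{H. subgraph H G} \<subseteq> Pow (verts G) \<times> Pow (edges G)"
    by (auto simp: subgraph_def)
  have "finite (edges G)"
    using assms finite_imp_finite_nsets finite_subset unfolding simple_graph_def by blast
  then show "finite (Pow (verts G) \<times> Pow (edges G))"
    using assms by (simp add: simple_graph_def)
qed

lemma fractional_colouring_exists:
  assumes "simple_graph G"
  shows "fractional_colouring G (\<lambda>_. 1)"
proof -
  have "1 \<le> (\<Sum>I | I \<in> independent_sets G \<and> v \<in> I. 1::real)" if "v \<in> verts G" for v
  proof -
    have "{v} \<in> {I. I \<in> independent_sets G \<and> v \<in> I}"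
      using that by (auto simp: independent_sets_def indep_def)
    moreover have "finite {I. I \<in> independent_sets G \<and> v \<in> I}"
      using finite_independent_sets[OF assms] by simp
    ultimately show ?thesis
      using sum_mono2[of "{I. I \<in> independent_sets G \<and> v \<in> I}" "{{v}}" "\<lambda>_. 1::real"] by simp
  qed
  then show ?thesis
    by (simp add: fractional_colouring_def)
qed

lemma fractional_chromatic_number_bdd_below:
  "bdd_below {\<Sum>I\<in>independent_sets G. x I | x. fractional_colouring G x}"
  by (rule bdd_belowI[of _ 0]) (auto simp: fractional_colouring_def intro!: sum_nonneg)

end

theory Submission
  imports Defs "HOL-Library.Nat_Bijection"
begin

text \<open>The graph is the lexicographic product \<open>F[V\<^sub>i]\<close> of a triangle-free graph \<open>F\<close>
  with \<open>\<chi>\<^sub>f(F)\<close> in \<open>(a, a + 1]\<close> and triangle-free graphs \<open>V\<^sub>i\<close>, one for each vertex \<open>i\<close>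
  of \<open>F\<close>, with \<open>v(V\<^sub>i) / \<alpha>(V\<^sub>i) > a\<close> and \<open>\<rho>(V\<^sub>i) \<le> a + 1\<close>, where \<open>a = P/4 - 1\<close>. A clique meets at
  most two fibres in at most two vertices each, and the fractional chromatic number is at
  least \<open>a\<^sup>2\<close>. The sizes of the \<open>V\<^sub>i\<close> grow so fast that all subsets of \<open>V\<^sub>i\<close> of size at most
  the total size of the previous graphs are bipartite. Take the last fibre
  of a subgraph that exceeds this threshold: the fibres before it at most double its
  contribution to the Hall ratio, and those after it contribute at most \<open>2 \<chi>\<^sub>f(F)\<close>, so the Hall
  ratio is at most \<open>2(a + 1) + 2(a + 1) = P\<close>.

  Both \<open>F\<close> and the \<open>V\<^sub>i\<close> are critical subgraphs of a graph on the cube \<open>{0,1}\<^sup>n\<close> that joins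
  nearly antipodal points. Its independent sets are small by concentration of measure, which the
  Poincare inequality of the cube provides.\<close>

text \<open>Edges not contained in \<open>S\<close> are ignored, so \<open>alpha S E\<close> is the independence number of
  the subgraph induced by \<open>S\<close>.\<close>

abbreviation alpha :: "'a set \<Rightarrow> 'a set set \<Rightarrow> nat" where
  "alpha S E \<equiv> independence_number (S, E)"

section \<open>Independence numbers of induced subgraphs\<close>

lemma finite_independent_sets_pair: "finite S \<Longrightarrow> finite (independent_sets (S, E))"
  by (rule finite_subset[of _ "Pow S"]) (auto simp: independent_sets_def)

lemma mem_independent_sets: "I \<in> independent_sets (S, E) \<longleftrightarrow> I \<subseteq> S \<and> indep I E"
  by (simp add: independent_sets_def)

lemma card_le_independence_number:
  assumes "finite (verts G)" "I \<subseteq> verts G" "indep I (edges G)"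
  shows "card I \<le> independence_number G"
proof -
  have "finite (independent_sets G)"
    using finite_independent_sets_pair[of "verts G" "edges G"] assms(1) by simp
  then show ?thesis
    unfolding independence_number_def using assms
    by (intro Max_ge) (auto simp: independent_sets_def)
qed

lemma independence_number_witness:
  assumes "finite (verts G)"
  obtains I where "I \<subseteq> verts G" "indep I (edges G)" "card I = independence_number G"
proof -
  have "finite (independent_sets G)"
    using finite_independent_sets_pair[of "verts G" "edges G"] assms(1) by simp
  then have "independence_number G \<in> card ` independent_sets G"
    unfolding independence_number_def by (intro Max_in) (simp_all add: independent_sets_nonempty)
  then show thesis using that by (auto simp: independent_sets_def)
qed

lemma alpha_mono:
  assumes "finite T" "S \<subseteq> T"
  shows "alpha S E \<le> alpha T E"
proof -
  have "finite S" using assms finite_subset by blast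
  then obtain I where "I \<subseteq> S" "indep I E" "card I = alpha S E"
    using independence_number_witness[of "(S, E)"] by auto
  then show ?thesis using card_le_independence_number[of "(T, E)" I] assms by auto
qed

lemma alpha_pos:
  assumes "finite S" "S \<noteq> {}"
  shows "1 \<le> alpha S E"
proof -
  obtain v where "v \<in> S" using assms by auto
  then show ?thesis
    using card_le_independence_number[of "(S, E)" "{v}"] assms by (auto simp: indep_def)
qed

section \<open>A graph on the cube\<close>

text \<open>Divided by \<open>2 * 4 ^ card A\<close>, this bounds the variance of a function that
  changes by at most 1 along each edge of the cube by a quarter of the dimension. The induction
  averages \<open>f\<close> over the new coordinate: the average \<open>h\<close> still changes by
  at most 1 along edges, and the variance along the new coordinate adds at most 1/4.\<close>

lemma cube_poincare:
  fixes f :: "'a set \<Rightarrow> real"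
  assumes "finite A" and "\<And>i X. i \<in> A \<Longrightarrow> i \<notin> X \<Longrightarrow> X \<subseteq> A \<Longrightarrow> \<bar>f (insert i X) - f X\<bar> \<le> 1"
  shows "(\<Sum>X\<in>Pow A. \<Sum>Y\<in>Pow A. (f X - f Y)\<^sup>2) \<le> 4 ^ card A * card A / 2"
  using assms
proof (induction A arbitrary: f rule: finite_induct)
  case empty
  then show ?case by simp
next
  case (insert a A)
  define g where "g X = f (insert a X)" for X
  define h where "h X = (f X + g X) / 2" for X
  have split: "(\<Sum>X\<in>Pow (insert a A). u X) = (\<Sum>X\<in>Pow A. u X + u (insert a X))"
    for u :: "'a set \<Rightarrow> real"
  proof -
    have "(\<Sum>X\<in>Pow (insert a A). u X) = sum u (Pow A) + sum u (insert a ` Pow A)"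
      unfolding Pow_insert using insert.hyps by (intro sum.union_disjoint) auto
    also have "sum u (insert a ` Pow A) = (\<Sum>X\<in>Pow A. u (insert a X))"
      using insert.hyps by (subst sum.reindex) (auto simp: inj_on_def)
    finally show ?thesis by (simp add: sum.distrib)
  qed
  have fg: "\<bar>g X - f X\<bar> \<le> 1" if "X \<in> Pow A" for X
    using insert.prems[of a X] insert.hyps that unfolding g_def by auto
  have IH: "(\<Sum>X\<in>Pow A. \<Sum>Y\<in>Pow A. (h X - h Y)\<^sup>2) \<le> 4 ^ card A * card A / 2"
  proof (rule insert.IH)
    fix i X assume i: "i \<in> A" "i \<notin> X" "X \<subseteq> A"
    have "\<bar>f (insert i X) - f X\<bar> \<le> 1" using i by (intro insert.prems) auto
    moreover have "\<bar>g (insert i X) - g X\<bar> \<le> 1"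
      unfolding g_def insert_commute[of a i]
      using i insert.hyps by (intro insert.prems) auto
    ultimately show "\<bar>h (insert i X) - h X\<bar> \<le> 1" unfolding h_def by argo
  qed
  have "(\<Sum>X\<in>Pow (insert a A). \<Sum>Y\<in>Pow (insert a A). (f X - f Y)\<^sup>2)
    = (\<Sum>X\<in>Pow A. \<Sum>Y\<in>Pow A. (f X - f Y)\<^sup>2 + (f X - g Y)\<^sup>2 + ((g X - f Y)\<^sup>2 + (g X - g Y)\<^sup>2))"
    by (simp add: split g_def sum.distrib)
  \<comment> \<open>The values \<open>f X\<close> and \<open>g X\<close> are the mean
    \<open>h X\<close> plus or minus half their difference. In the sum of the four squares the mixed
    terms cancel, which leaves the means and the two squared differences, each at most 1.\<close>
  also have "\<dots> \<le> (\<Sum>X\<in>Pow A. \<Sum>Y\<in>Pow A. 4 * (h X - h Y)\<^sup>2 + 2)"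
  proof (intro sum_mono)
    fix X Y assume X: "X \<in> Pow A" and Y: "Y \<in> Pow A"
    have 1: "(g X - f X)\<^sup>2 \<le> 1" "(g Y - f Y)\<^sup>2 \<le> 1"
      using fg[OF X] fg[OF Y] by (simp_all add: abs_square_le_1)
    have "(f X - f Y)\<^sup>2 + (f X - g Y)\<^sup>2 + ((g X - f Y)\<^sup>2 + (g X - g Y)\<^sup>2)
      = 4 * (h X - h Y)\<^sup>2 + (g X - f X)\<^sup>2 + (g Y - f Y)\<^sup>2"
      unfolding h_def by (simp add: power2_eq_square field_simps)
    with 1 show "(f X - f Y)\<^sup>2 + (f X - g Y)\<^sup>2 + ((g X - f Y)\<^sup>2 + (g X - g Y)\<^sup>2)
      \<le> 4 * (h X - h Y)\<^sup>2 + 2" by simp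
  qed
  also have "\<dots> = 4 * (\<Sum>X\<in>Pow A. \<Sum>Y\<in>Pow A. (h X - h Y)\<^sup>2) + 2 * 4 ^ card A"
    using insert.hyps
    by (simp add: sum.distrib sum_distrib_left card_Pow power_mult_distrib[symmetric])
  also have "\<dots> \<le> 4 * (4 ^ card A * card A / 2) + 2 * 4 ^ card A"
    using IH by linarith
  also have "\<dots> = 4 ^ card (insert a A) * card (insert a A) / 2"
    using insert.hyps by (simp add: field_simps)
  finally show ?case .
qed

text \<open>The size of this set is the Hamming distance from \<open>X\<close> to the antipode of
  \<open>Y\<close>, so it is small when the two points are nearly antipodal.\<close>

definition agree :: "nat \<Rightarrow> nat set \<Rightarrow> nat set \<Rightarrow> nat set" where
  "agree n X Y = {i \<in> {..<n}. i \<in> X \<longleftrightarrow> i \<in> Y}"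

lemma finite_agree [simp]: "finite (agree n X Y)"
  by (simp add: agree_def)

text \<open>Apply the Poincare inequality to the Hamming distance from the antipodal set of \<open>I\<close>:
  it exceeds \<open>t\<close> on \<open>I\<close> and vanishes on the antipodal set.\<close>

lemma card_agreeing_family:
  assumes I: "I \<subseteq> Pow {..<n}" and t: "\<And>X Y. X \<in> I \<Longrightarrow> Y \<in> I \<Longrightarrow> t \<le> card (agree n X Y)"
  shows "4 * (real t * card I)\<^sup>2 \<le> 4 ^ n * n"
proof (cases "I = {}")
  case True
  then show ?thesis by simp
next
  case False
  have fin: "finite I" using I finite_subset by blast
  define f where "f X = Min ((\<lambda>Y. card (agree n X Y)) ` I)" for X
  define B where "B = (\<lambda>X. {..<n} - X) ` I"
  have f_le: "f X \<le> card (agree n X Y)" if "Y \<in> I" for X Y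
    unfolding f_def using fin that by simp
  have f_ex: "\<exists>Y\<in>I. f X = card (agree n X Y)" for X
  proof -
    have "f X \<in> (\<lambda>Y. card (agree n X Y)) ` I" unfolding f_def using fin False by (intro Min_in) auto
    then show ?thesis by auto
  qed
  have step: "f X \<le> f X' + 1" if "\<And>Y. agree n X Y \<subseteq> insert i (agree n X' Y)" for X X' i
  proof -
    obtain Y where Y: "Y \<in> I" "f X' = card (agree n X' Y)" using f_ex by blast
    have "f X \<le> card (agree n X Y)" using f_le Y by simp
    also have "\<dots> \<le> card (insert i (agree n X' Y))" using that by (intro card_mono) auto
    also have "\<dots> \<le> f X' + 1" unfolding Y(2) by (simp add: card_insert_if)
    finally show ?thesis .
  qed
  have lip: "\<bar>real (f (insert i X)) - real (f X)\<bar> \<le> 1" for i X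
  proof -
    have "f (insert i X) \<le> f X + 1" by (rule step[where i = i]) (auto simp: agree_def)
    moreover have "f X \<le> f (insert i X) + 1" by (rule step[where i = i]) (auto simp: agree_def)
    ultimately show ?thesis by linarith
  qed
  have fI: "t \<le> f X" if "X \<in> I" for X
    using f_ex[of X] t that by auto
  have fB: "f X = 0" if "X \<in> B" for X
  proof -
    from that obtain Z where Z: "Z \<in> I" "X = {..<n} - Z" unfolding B_def by auto
    then have "agree n X Z = {}" by (auto simp: agree_def)
    then show ?thesis using f_le[OF Z(1), of X] by simp
  qed
  have "inj_on (\<lambda>X. {..<n} - X) I"
    using I by (intro inj_onI) (metis PowD double_diff equalityD2 subset_iff)
  then have cB: "card B = card I" unfolding B_def by (rule card_image)
  have BP: "B \<subseteq> Pow {..<n}" unfolding B_def by auto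
  have finB: "finite B" unfolding B_def using fin by simp
  show ?thesis
  proof (cases "t = 0")
    case True
    then show ?thesis by simp
  next
    case False
    then have disj: "I \<inter> B = {}" using fI fB by fastforce
    let ?D = "\<lambda>X Y. (real (f X) - real (f Y))\<^sup>2"
    have IB: "(real t * card I)\<^sup>2 \<le> (\<Sum>X\<in>I. \<Sum>Y\<in>B. ?D X Y)"
    proof -
      have "(\<Sum>X\<in>I. \<Sum>Y\<in>B. (real t)\<^sup>2) \<le> (\<Sum>X\<in>I. \<Sum>Y\<in>B. ?D X Y)"
        using fI fB by (intro sum_mono power_mono) auto
      then show ?thesis by (simp add: cB power2_eq_square mult_ac)
    qed
    \<comment> \<open>Counting the pairs between the disjoint sets \<open>I\<close> and
      \<open>B\<close> in both orders gives a factor 2, which with the half in the Poincare bound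
      makes up the constant 4.\<close>
    have "(\<Sum>X\<in>B. \<Sum>Y\<in>I. ?D X Y) = (\<Sum>X\<in>I. \<Sum>Y\<in>B. ?D X Y)"
      by (subst sum.swap) (simp add: power2_commute)
    with IB have "2 * (real t * card I)\<^sup>2 \<le> (\<Sum>X\<in>I. \<Sum>Y\<in>B. ?D X Y) + (\<Sum>X\<in>B. \<Sum>Y\<in>I. ?D X Y)"
      by simp
    also have "\<dots> \<le> (\<Sum>X\<in>I. \<Sum>Y\<in>Pow {..<n}. ?D X Y) + (\<Sum>X\<in>B. \<Sum>Y\<in>Pow {..<n}. ?D X Y)"
      using I BP by (intro add_mono sum_mono sum_mono2) auto
    also have "\<dots> = (\<Sum>X\<in>I \<union> B. \<Sum>Y\<in>Pow {..<n}. ?D X Y)"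
      using fin finB disj by (simp add: sum.union_disjoint)
    also have "\<dots> \<le> (\<Sum>X\<in>Pow {..<n}. \<Sum>Y\<in>Pow {..<n}. ?D X Y)"
      using I BP by (intro sum_mono2) (auto intro: sum_nonneg)
    also have "\<dots> \<le> 4 ^ n * n / 2"
      using cube_poincare[of "{..<n}" "\<lambda>X. real (f X)"] lip by simp
    finally show ?thesis by simp
  qed
qed

section \<open>Graphs whose small subgraphs are sparse\<close>

text \<open>A weak form of the demand that all induced subgraphs on at most \<open>N\<close>
  vertices be bipartite. It bounds the small fibres of a product by their independence numbers, and
  from \<open>N = 3\<close> on it excludes triangles.\<close>

definition locally_sparse :: "nat \<Rightarrow> 'a set \<Rightarrow> 'a set set \<Rightarrow> bool" where
  "locally_sparse N V E \<longleftrightarrow> (\<forall>S\<subseteq>V. card S \<le> N \<longrightarrow> card S \<le> 2 * alpha S E)"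

lemma locally_sparse_subset: "locally_sparse N V E \<Longrightarrow> U \<subseteq> V \<Longrightarrow> locally_sparse N U E"
  by (auto simp: locally_sparse_def)

lemma two_colourable_alpha:
  assumes "finite S" "indep {x\<in>S. P x} E" "indep {x\<in>S. \<not> P x} E"
  shows "card S \<le> 2 * alpha S E"
proof -
  have "S = {x\<in>S. P x} \<union> {x\<in>S. \<not> P x}" by auto
  then have "card S \<le> card {x\<in>S. P x} + card {x\<in>S. \<not> P x}"
    using card_Un_le by metis
  moreover have "card {x\<in>S. P x} \<le> alpha S E" "card {x\<in>S. \<not> P x} \<le> alpha S E"
    using assms by (auto intro!: card_le_independence_number[of "(S, E)", simplified])
  ultimately show ?thesis by simp
qed

text \<open>The vertices are the subsets of \<open>{..<n}\<close>, coded as naturals, adjacent when they are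
  nearly antipodal. The edges inside a set of few vertices miss only few of the \<open>n\<close> coordinates,
  so some coordinate separates the ends of all of them.\<close>

lemma locally_sparse_graph_exists:
  assumes "k \<ge> 1"
  shows "\<exists>(V :: nat set) E. finite V \<and> V \<noteq> {} \<and> k * alpha V E \<le> card V \<and> locally_sparse N V E"
proof -
  \<comment> \<open>Independent sets have size at most \<open>2 ^ n * sqrt n / (2 * t)\<close>.
    Taking \<open>n\<close> a square and \<open>t = k * m\<close> turns this into
    \<open>2 ^ n / (2 * k)\<close>. The size of \<open>m\<close> ensures
    \<open>N * N * t < n\<close>: at most \<open>N * N\<close> ordered pairs with at most
    \<open>t\<close> agreements each cannot exhaust the coordinates.\<close>
  define m where "m = (N * N + 1) * k + 1"
  define n where "n = m * m"
  define t where "t = k * m"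
  define V where "V = set_encode ` Pow {..<n}"
  define E where "E = {{x, y} | x y. card (agree n (set_decode x) (set_decode y)) \<le> t}"
  have m: "m > k" "m > N * N * k" "m > 0" unfolding m_def by auto
  have tn: "t < n" unfolding t_def n_def using m by simp
  have NN: "N * N * t < n" unfolding t_def n_def using m by (simp add: mult.assoc[symmetric])
  have fin_dec: "set_decode x \<subseteq> {..<n}" if "x \<in> V" for x
    using that unfolding V_def
    by (auto simp: finite_subset[OF _ finite_lessThan] set_encode_inverse)
  have inj_enc: "inj_on set_encode (Pow {..<n})"
    by (rule inj_on_subset[OF inj_on_set_encode]) (auto intro: finite_subset)
  have cV: "card V = 2 ^ n" unfolding V_def by (simp add: card_image[OF inj_enc] card_Pow)
  have finV: "finite V" unfolding V_def by simp
  have ne: "V \<noteq> {}" unfolding V_def by auto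
  have edge: "{x, y} \<in> E \<longleftrightarrow> card (agree n (set_decode x) (set_decode y)) \<le> t" for x y
  proof -
    have "agree n (set_decode x) (set_decode y) = agree n (set_decode y) (set_decode x)"
      by (auto simp: agree_def)
    then show ?thesis unfolding E_def by (auto simp: doubleton_eq_iff)
  qed
  have "k * alpha V E \<le> card V"
  proof -
    obtain I where I: "I \<subseteq> V" "indep I E" "card I = alpha V E"
      using independence_number_witness[of "(V, E)"] finV by auto
    have "4 * (real t * card (set_decode ` I))\<^sup>2 \<le> 4 ^ n * n"
    proof (rule card_agreeing_family)
      show "set_decode ` I \<subseteq> Pow {..<n}" using I(1) fin_dec by blast
      fix X Y assume "X \<in> set_decode ` I" "Y \<in> set_decode ` I"
      then obtain x y where xy: "x \<in> I" "y \<in> I" "X = set_decode x" "Y = set_decode y" by auto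
      show "t \<le> card (agree n X Y)"
      proof (cases "x = y")
        case True
        then have "agree n X Y = {..<n}" using xy by (auto simp: agree_def)
        then show ?thesis using tn by simp
      next
        case False
        then show ?thesis using I(2) xy edge[of x y] by (auto simp: indep_def)
      qed
    qed
    also have "card (set_decode ` I) = card I"
      by (rule card_image) (metis inj_onI set_decode_inverse)
    finally have "(2 * (real t * card I))\<^sup>2 \<le> (2 ^ n * real m)\<^sup>2"
      unfolding n_def by (simp add: power_mult_distrib power2_eq_square[of "real m"]
          power_mult[symmetric] mult.commute[of _ 2] power_mult[of 2 2, simplified])
    then have "2 * (real t * card I) \<le> 2 ^ n * real m"
      by (rule power2_le_imp_le) simp
    then have "2 * (k * card I) \<le> (2 ^ n :: real)"
      unfolding t_def using m(3) by (simp add: mult_ac)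
    then have "2 * (k * card I) \<le> 2 ^ n"
      by (metis of_nat_le_iff of_nat_numeral of_nat_power)
    then show ?thesis unfolding cV I(3)[symmetric] by linarith
  qed
  moreover have "locally_sparse N V E"
    unfolding locally_sparse_def
  proof (intro allI impI)
    fix S assume S: "S \<subseteq> V" "card S \<le> N"
    have finS: "finite S" using S finV finite_subset by blast
    define ES where "ES = {(x, y) \<in> S \<times> S. {x, y} \<in> E}"
    let ?ag = "\<lambda>(x, y). agree n (set_decode x) (set_decode y)"
    have ES: "finite ES" "card ES \<le> N * N"
    proof -
      have sub: "ES \<subseteq> S \<times> S" unfolding ES_def by auto
      then show "finite ES" using finS finite_subset by blast
      have "card ES \<le> card (S \<times> S)" using sub finS by (intro card_mono) auto
      also have "\<dots> \<le> N * N" using S by (simp add: card_cartesian_product mult_le_mono)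
      finally show "card ES \<le> N * N" .
    qed
    have "card (\<Union>e\<in>ES. ?ag e) \<le> (\<Sum>e\<in>ES. card (?ag e))"
      by (rule card_UN_le[OF ES(1)])
    also have "\<dots> \<le> card ES * t"
      using edge by (intro sum_bounded_above[of ES _ t, simplified]) (auto simp: ES_def)
    also have "\<dots> \<le> N * N * t" using ES by simp
    finally have "card (\<Union>e\<in>ES. ?ag e) < card {..<n}" using NN by simp
    then have "\<not> {..<n} \<subseteq> (\<Union>e\<in>ES. ?ag e)"
      using ES(1) by (metis (no_types, lifting) card_mono finite_UN finite_agree leD case_prod_beta)
    then obtain i where i: "i < n" "\<And>x y. (x, y) \<in> ES \<Longrightarrow> i \<notin> agree n (set_decode x) (set_decode y)"
      by blast
    show "card S \<le> 2 * alpha S E"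
      using i by (intro two_colourable_alpha[OF finS, of "\<lambda>x. i \<in> set_decode x"])
        (auto simp: indep_def ES_def agree_def)
  qed
  ultimately show ?thesis using finV ne by blast
qed


section \<open>Fractional colourings\<close>

text \<open>Double counting: every vertex is covered with total weight at least 1, and exchanging
  the sums collects the weights by independent sets. \<open>A\<close> is later the whole vertex set
  or a fibre of the product.\<close>

lemma fractional_colouring_sum_le:
  fixes w :: "'a \<Rightarrow> real"
  assumes "finite V" and y: "fractional_colouring (V, E) y" and "A \<subseteq> V"
    and w: "\<And>v. v \<in> A \<Longrightarrow> 0 \<le> w v"
  shows "(\<Sum>v\<in>A. w v) \<le> (\<Sum>I\<in>independent_sets (V, E). y I * (\<Sum>v\<in>I \<inter> A. w v))"
proof -
  let ?IS = "independent_sets (V, E)"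
  have fin: "finite ?IS" "finite A"
    using assms finite_independent_sets_pair finite_subset by auto
  have "(\<Sum>v\<in>A. w v) \<le> (\<Sum>v\<in>A. w v * (\<Sum>I | I \<in> ?IS \<and> v \<in> I. y I))"
  proof (rule sum_mono)
    fix v assume v: "v \<in> A"
    then have "1 \<le> (\<Sum>I | I \<in> ?IS \<and> v \<in> I. y I)"
      using y \<open>A \<subseteq> V\<close> by (auto simp: fractional_colouring_def)
    then show "w v \<le> w v * (\<Sum>I | I \<in> ?IS \<and> v \<in> I. y I)"
      using mult_left_mono[OF _ w[OF v], of 1] by simp
  qed
  also have "\<dots> = (\<Sum>v\<in>A. \<Sum>I\<in>?IS. if v \<in> I then y I * w v else 0)"
  proof (rule sum.cong[OF refl])
    fix v
    have "{I. I \<in> ?IS \<and> v \<in> I} = {I \<in> ?IS. v \<in> I}" by auto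
    then show "w v * (\<Sum>I | I \<in> ?IS \<and> v \<in> I. y I) = (\<Sum>I\<in>?IS. if v \<in> I then y I * w v else 0)"
      using fin by (auto simp: sum.inter_filter sum_distrib_left intro!: sum.cong)
  qed
  also have "\<dots> = (\<Sum>I\<in>?IS. \<Sum>v\<in>A. if v \<in> I then y I * w v else 0)"
    by (rule sum.swap)
  also have "\<dots> = (\<Sum>I\<in>?IS. y I * (\<Sum>v\<in>I \<inter> A. w v))"
  proof (rule sum.cong[OF refl])
    fix I
    show "(\<Sum>v\<in>A. if v \<in> I then y I * w v else 0) = y I * (\<Sum>v\<in>I \<inter> A. w v)"
      using fin by (simp add: sum.inter_restrict[symmetric] sum_distrib_left Int_commute)
  qed
  finally show ?thesis .
qed

text \<open>Weak linear programming duality: in the double count each independent set contributes at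
  most the weight of the heaviest one, which is taken as \<open>J\<close>.\<close>

lemma fractional_colouring_heavy_set:
  fixes w :: "'a \<Rightarrow> real"
  assumes "finite V" and y: "fractional_colouring (V, E) y"
    and c: "(\<Sum>I\<in>independent_sets (V, E). y I) \<le> c"
    and w: "\<And>v. v \<in> V \<Longrightarrow> 0 \<le> w v"
  obtains J where "J \<subseteq> V" "indep J E" "(\<Sum>v\<in>V. w v) \<le> c * (\<Sum>v\<in>J. w v)"
proof -
  let ?IS = "independent_sets (V, E)"
  define M where "M = Max ((\<lambda>J. \<Sum>v\<in>J. w v) ` ?IS)"
  have fin: "finite ?IS" using assms finite_independent_sets_pair by auto
  have "M \<in> (\<lambda>J. \<Sum>v\<in>J. w v) ` ?IS"
    unfolding M_def using fin by (intro Max_in) (simp_all add: independent_sets_nonempty)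
  then obtain J where J: "J \<in> ?IS" "M = (\<Sum>v\<in>J. w v)" by auto
  have M0: "0 \<le> M" unfolding J(2) using J(1) w by (intro sum_nonneg) (auto simp: mem_independent_sets)
  have "(\<Sum>v\<in>V. w v) \<le> (\<Sum>I\<in>?IS. y I * (\<Sum>v\<in>I \<inter> V. w v))"
    using fractional_colouring_sum_le[OF assms(1) y subset_refl w] .
  also have "\<dots> \<le> (\<Sum>I\<in>?IS. y I * M)"
  proof (intro sum_mono mult_left_mono)
    fix I assume I: "I \<in> ?IS"
    then have "I \<inter> V = I" by (auto simp: mem_independent_sets)
    then show "(\<Sum>v\<in>I \<inter> V. w v) \<le> M" unfolding M_def using fin I by simp
    show "0 \<le> y I" using y I by (simp add: fractional_colouring_def)
  qed
  also have "\<dots> \<le> c * M"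
    using c M0 by (simp add: sum_distrib_right[symmetric] mult_right_mono)
  finally show thesis using that J by (auto simp: mem_independent_sets)
qed

text \<open>One new colour class \<open>{v}\<close> of weight 1 covers the additional
  vertex.\<close>

lemma fractional_colouring_insert:
  assumes "finite V" "v \<in> V" and x: "fractional_colouring (V - {v}, E) x"
  shows "\<exists>x'. fractional_colouring (V, E) x' \<and>
    (\<Sum>I\<in>independent_sets (V, E). x' I) \<le> (\<Sum>I\<in>independent_sets (V - {v}, E). x I) + 1"
proof (intro exI conjI)
  let ?IS = "independent_sets (V, E)" and ?IS' = "independent_sets (V - {v}, E)"
  \<comment> \<open>The values of \<open>x\<close> on sets containing \<open>v\<close> are
    unconstrained and possibly negative, so they are reset to 0.\<close>
  let ?x = "\<lambda>I. if I = {v} then 1 else if v \<in> I then 0 else x I"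
  have fin: "finite ?IS" using assms finite_independent_sets_pair by auto
  have v: "{v} \<in> ?IS" using assms by (auto simp: mem_independent_sets indep_def)
  have sub: "?IS' \<subseteq> ?IS" and IS': "?IS' = {I \<in> ?IS. v \<notin> I}" by (auto simp: mem_independent_sets)
  have nonneg: "0 \<le> ?x I" if "I \<in> ?IS" for I
    using x that unfolding fractional_colouring_def IS' by auto
  show "fractional_colouring (V, E) ?x"
    unfolding fractional_colouring_def
  proof (intro conjI ballI)
    fix I assume "I \<in> independent_sets (V, E)" then show "0 \<le> ?x I" by (rule nonneg)
  next
    fix u assume u: "u \<in> verts (V, E)"
    show "1 \<le> (\<Sum>I | I \<in> ?IS \<and> u \<in> I. ?x I)"
    proof (cases "u = v")
      case True
      have "(\<Sum>I\<in>{{v}}. ?x I) \<le> (\<Sum>I | I \<in> ?IS \<and> u \<in> I. ?x I)"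
        using True v fin nonneg by (intro sum_mono2) auto
      then show ?thesis by simp
    next
      case False
      then have "1 \<le> (\<Sum>I | I \<in> ?IS' \<and> u \<in> I. x I)"
        using x u by (auto simp: fractional_colouring_def)
      also have "\<dots> = (\<Sum>I | I \<in> ?IS' \<and> u \<in> I. ?x I)"
        unfolding IS' by (intro sum.cong) auto
      also have "\<dots> \<le> (\<Sum>I | I \<in> ?IS \<and> u \<in> I. ?x I)"
        using fin sub nonneg by (intro sum_mono2) auto
      finally show ?thesis .
    qed
  qed
  have "(\<Sum>I\<in>?IS. ?x I) = (\<Sum>I\<in>insert {v} ?IS'. ?x I)"
    using fin v unfolding IS' by (intro sum.mono_neutral_right) auto
  also have "\<dots> = 1 + (\<Sum>I\<in>?IS'. ?x I)"
    using fin unfolding IS' by (subst sum.insert) auto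
  also have "(\<Sum>I\<in>?IS'. ?x I) = (\<Sum>I\<in>?IS'. x I)"
    unfolding IS' by (intro sum.cong) auto
  finally show "(\<Sum>I\<in>?IS. ?x I) \<le> (\<Sum>I\<in>?IS'. x I) + 1" by simp
qed

section \<open>Critical graphs\<close>

lemma locally_sparse_graph_real:
  fixes a :: real
  assumes "0 \<le> a"
  shows "\<exists>(V :: nat set) E. finite V \<and> a * alpha V E < card V \<and> locally_sparse N V E"
proof -
  \<comment> \<open>The summand 1 makes \<open>k\<close> strictly larger than \<open>a\<close> even
    if \<open>a\<close> is an integer.\<close>
  define k where "k = nat \<lceil>a\<rceil> + 1"
  have "k \<ge> 1" and ak: "a < real k" unfolding k_def using real_nat_ceiling_ge[of a] by simp_all
  then obtain V :: "nat set" and E where V: "finite V" "V \<noteq> {}" "k * alpha V E \<le> card V"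
    "locally_sparse N V E"
    using locally_sparse_graph_exists[of k N] by blast
  have "a * alpha V E < real k * alpha V E"
    using ak alpha_pos[OF V(1,2), of E] by (intro mult_strict_right_mono) auto
  also have "\<dots> \<le> card V" using V(3) by (metis of_nat_le_iff of_nat_mult)
  finally show ?thesis using V by blast
qed

text \<open>Take a smallest vertex set whose ratio of size to independence number exceeds
  \<open>a\<close>. All proper subsets have ratio at most \<open>a\<close>. For the set itself,
  deleting one vertex gives \<open>card V \<le> a * alpha V E + 1\<close>, and
  \<open>1 \<le> alpha V E\<close>.\<close>

lemma hall_critical_graph_exists:
  fixes a :: real
  assumes "0 \<le> a"
  shows "\<exists>(V :: nat set) E. finite V \<and> a * alpha V E < card V \<and>
    (\<forall>S\<subseteq>V. card S \<le> (a + 1) * alpha S E) \<and> locally_sparse N V E"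
proof -
  obtain V0 :: "nat set" and E where V0: "finite V0" "a * alpha V0 E < card V0" "locally_sparse N V0 E"
    using locally_sparse_graph_real[OF assms, of N] by blast
  define bad where "bad U \<longleftrightarrow> U \<subseteq> V0 \<and> a * alpha U E < card U" for U
  have "bad V0" using V0(2) by (simp add: bad_def)
  then obtain V where badV: "bad V" and min: "\<And>U. bad U \<Longrightarrow> card V \<le> card U"
    using ex_has_least_nat[of bad V0 card] by blast
  have V: "V \<subseteq> V0" "a * alpha V E < card V" using badV by (simp_all add: bad_def)
  have finV: "finite V" using V V0 finite_subset by blast
  have "card S \<le> (a + 1) * alpha S E" if S: "S \<subseteq> V" for S
  proof (cases "S = V")
    case False
    then have "card S < card V" using S finV by (intro psubset_card_mono) auto
    then have "\<not> bad S" using min[of S] leD by blast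
    then have "card S \<le> a * alpha S E" using S V(1) by (auto simp: bad_def)
    also have "\<dots> \<le> (a + 1) * alpha S E" by (intro mult_right_mono) auto
    finally show ?thesis .
  next
    case True
    have "V \<noteq> {}"
    proof
      assume "V = {}"
      then have "a * alpha V E < 0" using V(2) by simp
      then show False using mult_nonneg_nonneg[OF assms of_nat_0_le_iff[of "alpha V E"]] by linarith
    qed
    then obtain v where v: "v \<in> V" by auto
    then have c: "card V = Suc (card (V - {v}))" using finV by (metis card_Suc_Diff1)
    then have "\<not> card V \<le> card (V - {v})" by simp
    then have "\<not> bad (V - {v})" using min[of "V - {v}"] by blast
    then have "card (V - {v}) \<le> a * alpha (V - {v}) E" using V(1) by (auto simp: bad_def)
    also have "\<dots> \<le> a * alpha V E"
      using alpha_mono[OF finV, of "V - {v}" E] assms by (intro mult_left_mono) auto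
    finally show ?thesis
      using c alpha_pos[OF finV \<open>V \<noteq> {}\<close>, of E] unfolding True by (simp add: distrib_right)
  qed
  then show ?thesis using V finV locally_sparse_subset[OF V0(3)] by blast
qed

text \<open>The same minimality argument for the fractional chromatic number: deleting a vertex from
  a smallest bad set leaves a graph with a colouring of weight at most \<open>k\<close>, and
  restoring the vertex costs 1. Speaking of weights of colourings avoids the question whether the
  infimum is attained.\<close>

lemma fractionally_critical_graph_exists:
  fixes k :: real
  assumes "0 \<le> k"
  shows "\<exists>(V :: nat set) E. finite V \<and> locally_sparse N V E \<and>
    (\<exists>x. fractional_colouring (V, E) x \<and> (\<Sum>I\<in>independent_sets (V, E). x I) \<le> k + 1) \<and>
    (\<forall>x. fractional_colouring (V, E) x \<longrightarrow> k < (\<Sum>I\<in>independent_sets (V, E). x I))"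
proof -
  obtain V0 :: "nat set" and E where V0: "finite V0" "k * alpha V0 E < card V0" "locally_sparse N V0 E"
    using locally_sparse_graph_real[OF assms, of N] by blast
  let ?bad = "\<lambda>U. U \<subseteq> V0 \<and>
    (\<forall>x. fractional_colouring (U, E) x \<longrightarrow> k < (\<Sum>I\<in>independent_sets (U, E). x I))"
  have "?bad V0"
  proof (intro conjI allI impI subset_refl)
    fix x assume x: "fractional_colouring (V0, E) x"
    let ?IS = "independent_sets (V0, E)"
    \<comment> \<open>With unit weights, double counting shows that every colouring has weight at
      least \<open>card V0 / alpha V0 E\<close>.\<close>
    have "(\<Sum>v\<in>V0. 1::real) \<le> (\<Sum>I\<in>?IS. x I * (\<Sum>v\<in>I \<inter> V0. 1))"
      using V0(1) x by (intro fractional_colouring_sum_le) auto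
    also have "\<dots> \<le> (\<Sum>I\<in>?IS. x I * alpha V0 E)"
      using x card_le_independence_number[of "(V0, E)"] V0(1)
      by (intro sum_mono mult_left_mono)
        (auto simp: fractional_colouring_def mem_independent_sets Int_absorb2)
    finally have "real (card V0) \<le> (\<Sum>I\<in>?IS. x I) * alpha V0 E"
      by (simp add: sum_distrib_right)
    with V0(2) have "k * alpha V0 E < (\<Sum>I\<in>?IS. x I) * alpha V0 E" by simp
    then show "k < (\<Sum>I\<in>?IS. x I)" by (simp add: mult_less_cancel_right)
  qed
  then obtain V where V: "?bad V" and min: "\<And>U. ?bad U \<Longrightarrow> card V \<le> card U"
    using ex_has_least_nat[of ?bad V0 card] by blast
  have finV: "finite V" using V V0 finite_subset by blast
  have "V \<noteq> {}"
  proof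
    assume "V = {}"
    \<comment> \<open>Without vertices there is no covering constraint, so a colouring of weight 0
      contradicts the lower bound.\<close>
    then have "fractional_colouring (V, E) (\<lambda>_. 0)" by (simp add: fractional_colouring_def)
    then show False using V assms by fastforce
  qed
  then obtain v where v: "v \<in> V" by auto
  then have "card (V - {v}) < card V" using finV by (rule card_Diff1_less[rotated])
  then have "\<not> ?bad (V - {v})" using min[of "V - {v}"] leD by blast
  then obtain x where "fractional_colouring (V - {v}, E) x"
    "(\<Sum>I\<in>independent_sets (V - {v}, E). x I) \<le> k"
    using V by (auto simp: not_less)
  then have "\<exists>x. fractional_colouring (V, E) x \<and> (\<Sum>I\<in>independent_sets (V, E). x I) \<le> k + 1"
    using fractional_colouring_insert[OF finV v] by (meson add_right_mono order_trans)
  then show ?thesis using V finV locally_sparse_subset[OF V0(3)] by blast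
qed

text \<open>Three vertices of a clique have independence number at most 1, whereas local sparsity
  demands at least 3/2.\<close>

lemma locally_sparse_clique:
  assumes "locally_sparse N V E" "3 \<le> N" "finite K" "K \<subseteq> V" "clique K E"
  shows "card K \<le> 2"
proof (rule ccontr)
  assume "\<not> card K \<le> 2"
  then obtain T where T: "T \<subseteq> K" "card T = 3"
    using obtain_subset_with_card_n[of 3 K] by auto
  have finT: "finite T" using T assms finite_subset by blast
  obtain I where I: "I \<subseteq> T" "indep I E" "card I = alpha T E"
    using independence_number_witness[of "(T, E)"] finT by auto
  have "x = y" if "x \<in> I" "y \<in> I" for x y
    using I(1,2) T(1) assms(5) that unfolding indep_def clique_def by blast
  then have "card I \<le> Suc 0"
    using I(1) finT finite_subset by (subst card_le_Suc0_iff_eq) auto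
  moreover have "3 \<le> 2 * alpha T E"
    using assms(1,2,4) T unfolding locally_sparse_def by (metis order_trans)
  ultimately show False using I(3) by simp
qed

section \<open>Lexicographic products\<close>

text \<open>The coordinates of a vertex are given by functions \<open>p\<close> and \<open>q\<close>
  instead of a pair, so that the vertices of the product can be coded as natural numbers.\<close>

definition lex_edges :: "('c \<Rightarrow> 'a) \<Rightarrow> ('c \<Rightarrow> 'b) \<Rightarrow> 'a set set \<Rightarrow> ('a \<Rightarrow> 'b set set) \<Rightarrow> 'c set set" where
  "lex_edges p q F E = {{x, y} | x y.
    p x \<noteq> p y \<and> {p x, p y} \<in> F \<or> p x = p y \<and> {q x, q y} \<in> E (p x)}"

lemma lex_edges_iff:
  "{x, y} \<in> lex_edges p q F E \<longleftrightarrow>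
    p x \<noteq> p y \<and> {p x, p y} \<in> F \<or> p x = p y \<and> {q x, q y} \<in> E (p x)"
  (is "_ \<longleftrightarrow> ?A x y")
proof -
  have sym: "?A x y \<longleftrightarrow> ?A y x"
    by (metis (no_types) insert_commute)
  have "{x, y} \<in> lex_edges p q F E \<longleftrightarrow> (\<exists>u v. {x, y} = {u, v} \<and> ?A u v)"
    unfolding lex_edges_def by blast
  also have "\<dots> \<longleftrightarrow> ?A x y \<or> ?A y x"
    unfolding doubleton_eq_iff by blast
  finally show ?thesis using sym by blast
qed

text \<open>The linear order on the vertices of \<open>F\<close> is the order in which the fibres
  grow.\<close>

locale lex_product =
  fixes VF :: "'a :: linorder set" and F :: "'a set set" and V :: "'a \<Rightarrow> 'b set" and E :: "'a \<Rightarrow> 'b set set"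
    and p :: "'c \<Rightarrow> 'a" and q :: "'c \<Rightarrow> 'b" and W :: "'c set"
  assumes finite_VF: "finite VF" and finite_V: "\<And>i. finite (V i)"
    and bij: "bij_betw (\<lambda>x. (p x, q x)) W (Sigma VF V)"
begin

abbreviation EW :: "'c set set" where
  "EW \<equiv> lex_edges p q F E"

definition fibre :: "'c set \<Rightarrow> 'a \<Rightarrow> 'b set" where
  "fibre S i = q ` {x \<in> S. p x = i}"

lemma finite_W: "finite W"
  using bij_betw_finite[OF bij] finite_SigmaI[OF finite_VF finite_V] by simp

lemma W_D: "x \<in> W \<Longrightarrow> p x \<in> VF" "x \<in> W \<Longrightarrow> q x \<in> V (p x)"
  using bij_betwE[OF bij] by auto

lemma W_eqI: "x \<in> W \<Longrightarrow> y \<in> W \<Longrightarrow> p x = p y \<Longrightarrow> q x = q y \<Longrightarrow> x = y"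
  using inj_onD[OF bij_betw_imp_inj_on[OF bij], of x y] by simp

lemma finite_subset_W: "S \<subseteq> W \<Longrightarrow> finite S"
  using finite_W finite_subset by blast

lemma inj_on_q: "S \<subseteq> W \<Longrightarrow> inj_on q {x \<in> S. p x = i}"
  unfolding inj_on_def by (blast intro: W_eqI)

lemma fibre_subset: "S \<subseteq> W \<Longrightarrow> fibre S i \<subseteq> V i"
  using W_D(2) by (auto simp: fibre_def)

lemma fibre_W: "i \<in> VF \<Longrightarrow> fibre W i = V i"
proof (intro subset_antisym fibre_subset subset_refl subsetI)
  fix v assume "i \<in> VF" "v \<in> V i"
  then have "(i, v) \<in> (\<lambda>x. (p x, q x)) ` W" using bij by (auto simp: bij_betw_def)
  then show "v \<in> fibre W i" by (auto simp: fibre_def)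
qed

lemma card_fibre: "S \<subseteq> W \<Longrightarrow> card (fibre S i) = card {x \<in> S. p x = i}"
  unfolding fibre_def by (rule card_image[OF inj_on_q])

lemma card_eq_sum_fibre:
  assumes "S \<subseteq> W" "p ` S \<subseteq> J" "finite J"
  shows "card S = (\<Sum>i\<in>J. card (fibre S i))"
proof -
  have "(\<Sum>x\<in>S. 1) = (\<Sum>i\<in>J. \<Sum>x | x \<in> S \<and> p x = i. 1::nat)"
    using sum.group[of S J p "\<lambda>_. 1::nat"] assms finite_subset_W by auto
  then show ?thesis using card_fibre[OF assms(1)] by simp
qed

lemma indep_fibre:
  assumes "indep T EW"
  shows "indep (fibre T i) (E i)"
  unfolding indep_def
proof (intro ballI impI)
  fix v w assume vw: "v \<in> fibre T i" "w \<in> fibre T i" "v \<noteq> w"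
  then obtain x y where xy: "x \<in> T" "p x = i" "v = q x" "y \<in> T" "p y = i" "w = q y"
    by (auto simp: fibre_def)
  have "x \<noteq> y" using xy vw(3) by auto
  then have "{x, y} \<notin> EW" using assms xy(1,4) unfolding indep_def by blast
  then show "{v, w} \<notin> E i" using xy by (simp add: lex_edges_iff)
qed

lemma indep_proj:
  assumes "indep T EW"
  shows "indep (p ` T) F"
  unfolding indep_def
proof (intro ballI impI)
  fix i j assume ij: "i \<in> p ` T" "j \<in> p ` T" "i \<noteq> j"
  then obtain x y where xy: "x \<in> T" "p x = i" "y \<in> T" "p y = j"
    by auto
  have "x \<noteq> y" using xy ij(3) by auto
  then have "{x, y} \<notin> EW" using assms xy(1,3) unfolding indep_def by blast
  then show "{i, j} \<notin> F" using xy ij(3) by (simp add: lex_edges_iff)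
qed

lemma clique_fibre:
  assumes "clique T EW"
  shows "clique (fibre T i) (E i)"
  unfolding clique_def
proof (intro ballI impI)
  fix v w assume vw: "v \<in> fibre T i" "w \<in> fibre T i" "v \<noteq> w"
  then obtain x y where xy: "x \<in> T" "p x = i" "v = q x" "y \<in> T" "p y = i" "w = q y"
    by (auto simp: fibre_def)
  have "x \<noteq> y" using xy vw(3) by auto
  then have "{x, y} \<in> EW" using assms xy(1,4) unfolding clique_def by blast
  then show "{v, w} \<in> E i" using xy by (simp add: lex_edges_iff)
qed

lemma clique_proj:
  assumes "clique T EW"
  shows "clique (p ` T) F"
  unfolding clique_def
proof (intro ballI impI)
  fix i j assume ij: "i \<in> p ` T" "j \<in> p ` T" "i \<noteq> j"
  then obtain x y where xy: "x \<in> T" "p x = i" "y \<in> T" "p y = j"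
    by auto
  have "x \<noteq> y" using xy ij(3) by auto
  then have "{x, y} \<in> EW" using assms xy(1,3) unfolding clique_def by blast
  then show "{i, j} \<in> F" using xy ij(3) by (simp add: lex_edges_iff)
qed

text \<open>Over an independent set of \<open>F\<close> there are no edges between different fibres,
  so largest independent sets of the fibres unite to an independent set of the product.\<close>

lemma sum_alpha_fibre_le:
  assumes S: "S \<subseteq> W" and J: "J \<subseteq> VF" "indep J F"
  shows "(\<Sum>i\<in>J. alpha (fibre S i) (E i)) \<le> alpha S EW"
proof -
  have finJ: "finite J" using J finite_VF finite_subset by blast
  have "\<exists>I. I \<subseteq> fibre S i \<and> indep I (E i) \<and> card I = alpha (fibre S i) (E i)" for i
    using independence_number_witness[of "(fibre S i, E i)"]
      finite_subset[OF fibre_subset[OF S] finite_V] by (metis fst_conv snd_conv)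
  then obtain I where I: "\<And>i. I i \<subseteq> fibre S i" "\<And>i. indep (I i) (E i)"
    "\<And>i. card (I i) = alpha (fibre S i) (E i)" by metis
  define T where "T = {x \<in> S. p x \<in> J \<and> q x \<in> I (p x)}"
  have TS: "T \<subseteq> S" and TW: "T \<subseteq> W" using S by (auto simp: T_def)
  have fT: "fibre T i = I i" if "i \<in> J" for i
    using I(1)[of i] that by (auto simp: fibre_def T_def)
  have "indep T EW"
    unfolding indep_def
  proof (intro ballI impI)
    fix x y assume xy: "x \<in> T" "y \<in> T" "x \<noteq> y"
    show "{x, y} \<notin> EW"
    proof (cases "p x = p y")
      case True
      then have "q x \<noteq> q y" using W_eqI xy TW by blast
      then have "{q x, q y} \<notin> E (p x)"
        using I(2)[of "p x"] xy True by (auto simp: indep_def T_def)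
      then show ?thesis using True by (simp add: lex_edges_iff)
    next
      case False
      then have "{p x, p y} \<notin> F" using J(2) xy by (auto simp: indep_def T_def)
      then show ?thesis using False by (simp add: lex_edges_iff)
    qed
  qed
  then have "card T \<le> alpha S EW"
    using card_le_independence_number[of "(S, EW)" T] TS finite_subset_W[OF S] by simp
  moreover have "card T = (\<Sum>i\<in>J. card (fibre T i))"
    using TW finJ by (intro card_eq_sum_fibre) (auto simp: T_def)
  ultimately show ?thesis using fT I(3) by simp
qed

text \<open>An independent set of the product covers at most \<open>alpha (V i) (E i)\<close>
  vertices of fibre \<open>i\<close>, so the sets meeting this fibre have total weight at least
  \<open>card (V i) / alpha (V i) (E i)\<close>, hence at least \<open>a\<close>. Their projections
  are independent in \<open>F\<close>. Pushing \<open>y\<close> forward along the projection and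
  dividing by \<open>a\<close> therefore yields a fractional colouring of \<open>F\<close>.\<close>

lemma fractional_weight_ge:
  fixes a k :: real
  assumes a: "0 < a" "\<And>i. i \<in> VF \<Longrightarrow> a * alpha (V i) (E i) \<le> card (V i)"
    and V: "\<And>i. i \<in> VF \<Longrightarrow> V i \<noteq> {}"
    and k: "\<And>z. fractional_colouring (VF, F) z \<Longrightarrow> k \<le> (\<Sum>J\<in>independent_sets (VF, F). z J)"
    and y: "fractional_colouring (W, EW) y"
  shows "a * k \<le> (\<Sum>I\<in>independent_sets (W, EW). y I)"
proof -
  let ?IS = "independent_sets (W, EW)" and ?JS = "independent_sets (VF, F)"
  define z where "z J = (\<Sum>I | I \<in> ?IS \<and> p ` I = J. y I) / a" for J
  have fin: "finite ?IS" "finite ?JS"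
    using finite_W finite_VF finite_independent_sets_pair by auto
  have y0: "0 \<le> y I" if "I \<in> ?IS" for I
    using y that by (simp add: fractional_colouring_def)
  have proj: "p ` I \<in> ?JS" if "I \<in> ?IS" for I
    using that W_D(1) indep_proj by (fastforce simp: mem_independent_sets)
  \<comment> \<open>Used once for the independent sets through a given vertex, to verify the
    covering condition, and once for all of them, to compute the total weight.\<close>
  have group: "(\<Sum>J\<in>Q. z J) = (\<Sum>I | I \<in> ?IS \<and> p ` I \<in> Q. y I) / a" if "Q \<subseteq> ?JS" for Q
  proof -
    have "(\<Sum>J\<in>Q. \<Sum>I | I \<in> {I \<in> ?IS. p ` I \<in> Q} \<and> p ` I = J. y I) = (\<Sum>I\<in>{I \<in> ?IS. p ` I \<in> Q}. y I)"
      using fin that finite_subset by (intro sum.group) auto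
    moreover have "{I. I \<in> {I \<in> ?IS. p ` I \<in> Q} \<and> p ` I = J} = {I. I \<in> ?IS \<and> p ` I = J}"
      if "J \<in> Q" for J using that by auto
    ultimately show ?thesis by (simp add: z_def sum_divide_distrib[symmetric])
  qed
  have "fractional_colouring (VF, F) z"
    unfolding fractional_colouring_def
  proof (intro conjI ballI)
    fix J show "0 \<le> z J" unfolding z_def using a y0 by (auto intro!: divide_nonneg_pos sum_nonneg)
  next
    fix i assume "i \<in> verts (VF, F)"
    then have i: "i \<in> VF" by simp
    let ?A = "{x \<in> W. p x = i}"
    let ?s = "\<Sum>I | I \<in> ?IS \<and> i \<in> p ` I. y I"
    have bound: "card (I \<inter> ?A) \<le> (if i \<in> p ` I then alpha (V i) (E i) else 0)" if I: "I \<in> ?IS" for I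
    proof (cases "i \<in> p ` I")
      case True
      have IW: "I \<subseteq> W" "indep I EW" using I by (auto simp: mem_independent_sets)
      then have "I \<inter> ?A = {x \<in> I. p x = i}" by auto
      then have "card (I \<inter> ?A) = card (fibre I i)" using card_fibre[OF IW(1)] by simp
      also have "\<dots> \<le> alpha (V i) (E i)"
        using card_le_independence_number[of "(V i, E i)" "fibre I i"] finite_V[of i]
          fibre_subset[OF IW(1)] indep_fibre[OF IW(2)] by simp
      finally show ?thesis using True by simp
    next
      case False
      then have "I \<inter> ?A = {}" by auto
      then show ?thesis using False by simp
    qed
    have "real (card (V i)) = (\<Sum>x\<in>?A. 1)"
      using card_fibre[of W i] fibre_W[OF i] by simp
    also have "\<dots> \<le> (\<Sum>I\<in>?IS. y I * (\<Sum>x\<in>I \<inter> ?A. 1))"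
      using finite_W y by (intro fractional_colouring_sum_le) auto
    also have "\<dots> \<le> (\<Sum>I\<in>?IS. if i \<in> p ` I then y I * alpha (V i) (E i) else 0)"
    proof (rule sum_mono)
      fix I assume I: "I \<in> ?IS"
      have "y I * card (I \<inter> ?A) \<le> y I * (if i \<in> p ` I then alpha (V i) (E i) else 0)"
        using bound[OF I] y0[OF I] by (intro mult_left_mono) simp_all
      then show "y I * (\<Sum>x\<in>I \<inter> ?A. 1) \<le> (if i \<in> p ` I then y I * alpha (V i) (E i) else 0)"
        by (simp split: if_splits)
    qed
    also have "\<dots> = ?s * alpha (V i) (E i)"
    proof -
      have "{I. I \<in> ?IS \<and> i \<in> p ` I} = {I \<in> ?IS. i \<in> p ` I}" by auto
      then show ?thesis using fin by (auto simp: sum.inter_filter sum_distrib_right intro!: sum.cong)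
    qed
    finally have "a * alpha (V i) (E i) \<le> ?s * alpha (V i) (E i)"
      using a(2)[OF i] by linarith
    moreover have "0 < real (alpha (V i) (E i))"
      using alpha_pos[OF finite_V V[OF i], of "E i"] by simp
    ultimately have "a \<le> ?s" by (simp only: mult_le_cancel_right_pos)
    moreover have "(\<Sum>J | J \<in> ?JS \<and> i \<in> J. z J) = ?s / a"
    proof -
      have "{I. I \<in> ?IS \<and> p ` I \<in> {J. J \<in> ?JS \<and> i \<in> J}} = {I. I \<in> ?IS \<and> i \<in> p ` I}"
        using proj by auto
      then show ?thesis using group[of "{J. J \<in> ?JS \<and> i \<in> J}"] by auto
    qed
    ultimately show "1 \<le> (\<Sum>J | J \<in> ?JS \<and> i \<in> J. z J)" using a by simp
  qed
  then have "k \<le> (\<Sum>J\<in>?JS. z J)" by (rule k)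
  also have "\<dots> = (\<Sum>I\<in>?IS. y I) / a"
  proof -
    have "{I. I \<in> ?IS \<and> p ` I \<in> ?JS} = ?IS" using proj by auto
    then show ?thesis using group[of ?JS] by simp
  qed
  finally show ?thesis using a by (simp add: field_simps)
qed

text \<open>\<open>N i\<close> is both the sparsity threshold of fibre \<open>i\<close> and a bound
  for the total size of the fibres before it. Fibres in which \<open>S\<close> stays within the
  threshold cost twice their independence numbers, and these numbers sum to at most
  \<open>c * alpha S EW\<close>.\<close>

lemma card_le_alpha:
  fixes a c :: real and N :: "'a \<Rightarrow> nat"
  assumes a: "0 \<le> a" "\<And>i S. i \<in> VF \<Longrightarrow> S \<subseteq> V i \<Longrightarrow> card S \<le> a * alpha S (E i)"
    and sparse: "\<And>i. i \<in> VF \<Longrightarrow> locally_sparse (N i) (V i) (E i)"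
    and N: "\<And>i. i \<in> VF \<Longrightarrow> (\<Sum>j | j \<in> VF \<and> j < i. card (V j)) \<le> N i"
    and z: "fractional_colouring (VF, F) z" "(\<Sum>J\<in>independent_sets (VF, F). z J) \<le> c"
    and S: "S \<subseteq> W"
  shows "card S \<le> (2 * a + 2 * c) * alpha S EW"
proof -
  define h where "h i = card (fibre S i)" for i
  define al where "al i = alpha (fibre S i) (E i)" for i
  have "p ` S \<subseteq> VF" using S W_D(1) by auto
  then have cS: "real (card S) = (\<Sum>i\<in>VF. real (h i))"
    using card_eq_sum_fibre[OF S _ finite_VF] by (simp add: h_def)
  have fin_fib: "finite (fibre S i)" for i
    using fibre_subset[OF S] finite_V finite_subset by blast
  have c0: "0 \<le> c"
    using z(1) by (intro order_trans[OF sum_nonneg z(2)]) (auto simp: fractional_colouring_def)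
  \<comment> \<open>Each vertex of \<open>F\<close> is weighted by the independence number of its
    fibre. The total is at most \<open>c\<close> times the weight over \<open>J\<close>, and over
    \<open>J\<close> the independent sets of the fibres combine.\<close>
  obtain J where J: "J \<subseteq> VF" "indep J F" "(\<Sum>i\<in>VF. real (al i)) \<le> c * (\<Sum>i\<in>J. real (al i))"
    using fractional_colouring_heavy_set[OF finite_VF z, of "\<lambda>i. real (al i)"] by auto
  have "(\<Sum>i\<in>J. real (al i)) \<le> alpha S EW"
    using sum_alpha_fibre_le[OF S J(1,2)] unfolding al_def by (metis of_nat_le_iff of_nat_sum)
  with J(3) c0 have sum_al: "(\<Sum>i\<in>VF. real (al i)) \<le> c * alpha S EW"
    by (meson mult_left_mono order_trans)
  have small: "real (h i) \<le> 2 * al i" if "i \<in> VF" "h i \<le> N i" for i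
    using sparse[OF that(1)] fibre_subset[OF S, of i] that(2)
    unfolding locally_sparse_def h_def al_def by (metis of_nat_le_iff of_nat_mult of_nat_numeral)
  have small_sum: "(\<Sum>i\<in>Q. real (h i)) \<le> 2 * (c * alpha S EW)"
    if Q: "Q \<subseteq> VF" "\<And>i. i \<in> Q \<Longrightarrow> h i \<le> N i" for Q
  proof -
    have "(\<Sum>i\<in>Q. real (h i)) \<le> (\<Sum>i\<in>Q. 2 * real (al i))"
      using small Q by (intro sum_mono) auto
    also have "\<dots> \<le> (\<Sum>i\<in>VF. 2 * real (al i))"
      using Q finite_VF by (intro sum_mono2) auto
    finally show ?thesis using sum_al by (simp add: sum_distrib_left[symmetric])
  qed
  define Big where "Big = {i \<in> VF. N i < h i}"
  show ?thesis
  proof (cases "Big = {}")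
    case True
    then have "real (card S) \<le> 2 * (c * alpha S EW)"
      unfolding cS by (intro small_sum) (auto simp: Big_def not_less)
    also have "\<dots> \<le> (2 * a + 2 * c) * alpha S EW"
      using a(1) by (simp add: algebra_simps)
    finally show ?thesis .
  next
    case False
    have finB: "finite Big" using finite_VF by (simp add: Big_def)
    \<comment> \<open>Only this last large fibre is charged with the ratio \<open>a\<close>. The
      fibres before it have at most \<open>N m < h m\<close> vertices altogether, so they are
      charged to it as well, which gives \<open>2 * a\<close>.\<close>
    define m where "m = Max Big"
    have m: "m \<in> VF" "N m < h m"
      using Max_in[OF finB False] by (auto simp: m_def Big_def)
    have max: "h i \<le> N i" if "i \<in> VF" "m < i" for i
    proof (rule ccontr)
      assume "\<not> h i \<le> N i"
      then have "i \<in> Big" using that by (simp add: Big_def)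
      then have "i \<le> m" unfolding m_def by (rule Max_ge[OF finB])
      then show False using that by simp
    qed
    let ?L = "{j \<in> VF. j < m}" and ?R = "{j \<in> VF. m < j}"
    have VF: "VF = ?L \<union> ({m} \<union> ?R)" using m by auto
    have "(\<Sum>i\<in>VF. real (h i)) = (\<Sum>i\<in>?L. real (h i)) + (\<Sum>i\<in>{m} \<union> ?R. real (h i))"
      by (subst VF, rule sum.union_disjoint) (use finite_VF in auto)
    also have "(\<Sum>i\<in>{m} \<union> ?R. real (h i)) = h m + (\<Sum>i\<in>?R. real (h i))"
      using finite_VF by (subst sum.union_disjoint) auto
    finally have split: "real (card S) = (\<Sum>i\<in>?L. real (h i)) + (h m + (\<Sum>i\<in>?R. real (h i)))"
      unfolding cS .
    have "(\<Sum>i\<in>?L. h i) \<le> (\<Sum>i\<in>?L. card (V i))"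
      unfolding h_def using fibre_subset[OF S] finite_V by (intro sum_mono card_mono) auto
    also have "\<dots> \<le> N m" using N[OF m(1)] by simp
    also have "\<dots> \<le> h m" using m by simp
    finally have "(\<Sum>i\<in>?L. real (h i)) \<le> h m" by (metis of_nat_le_iff of_nat_sum)
    moreover have "(\<Sum>i\<in>?R. real (h i)) \<le> 2 * (c * alpha S EW)"
      using max by (intro small_sum) auto
    moreover have "real (h m) \<le> a * alpha S EW"
    proof -
      have "al m \<le> alpha S EW"
        using sum_alpha_fibre_le[OF S, of "{m}"] m(1) by (simp add: al_def indep_def)
      moreover have "real (h m) \<le> a * al m"
        unfolding h_def al_def using m(1) fibre_subset[OF S] by (intro a(2)) auto
      ultimately show ?thesis using a(1) by (meson mult_left_mono of_nat_le_iff order_trans)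
    qed
    ultimately show ?thesis unfolding split by (simp add: algebra_simps)
  qed
qed

text \<open>The projection of a clique to \<open>F\<close> and its part in each fibre are again
  cliques, and thresholds of at least 3 limit each of them to two vertices.\<close>

lemma card_clique_le:
  assumes "K \<subseteq> W" "clique K EW" and F: "locally_sparse 3 VF F"
    and E: "\<And>i. i \<in> VF \<Longrightarrow> locally_sparse (N i) (V i) (E i)" "\<And>i. i \<in> VF \<Longrightarrow> 3 \<le> N i"
  shows "card K \<le> 4"
proof -
  have pK: "p ` K \<subseteq> VF" using assms(1) W_D(1) by auto
  then have fin: "finite (p ` K)" using finite_VF finite_subset by blast
  have "card (p ` K) \<le> 2"
    using locally_sparse_clique[OF F order_refl fin pK clique_proj[OF assms(2)]] .
  have "card (fibre K i) \<le> 2" if "i \<in> VF" for i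
    using locally_sparse_clique[OF E[OF that] _ fibre_subset[OF assms(1)] clique_fibre[OF assms(2)]]
      finite_subset[OF fibre_subset[OF assms(1)] finite_V] by blast
  then have "(\<Sum>i\<in>p ` K. card (fibre K i)) \<le> (\<Sum>i\<in>p ` K. 2)"
    using pK by (intro sum_mono) auto
  also have "\<dots> \<le> 4" using \<open>card (p ` K) \<le> 2\<close> by simp
  finally show ?thesis using card_eq_sum_fibre[OF assms(1) subset_refl fin] by simp
qed

end

section \<open>Choice of the fibre sizes and assembly of the graph\<close>

text \<open>Here \<open>s n\<close> stands for the size of the graph chosen for threshold
  \<open>n\<close>. Each threshold exceeds the total size of the graphs chosen for the earlier
  thresholds, and the initial 3 excludes triangles.\<close>

primrec sparsity_threshold :: "(nat \<Rightarrow> nat) \<Rightarrow> nat \<Rightarrow> nat" where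
  "sparsity_threshold s 0 = 3"
| "sparsity_threshold s (Suc i) = sparsity_threshold s i + s (sparsity_threshold s i)"

lemma sparsity_threshold_eq:
  "sparsity_threshold s i = 3 + (\<Sum>j<i. s (sparsity_threshold s j))"
proof (induction i)
  case (Suc i)
  have "sparsity_threshold s (Suc i) = sparsity_threshold s i + s (sparsity_threshold s i)"
    by simp
  also have "\<dots> = 3 + (\<Sum>j<i. s (sparsity_threshold s j)) + s (sparsity_threshold s i)"
    by (subst (1) Suc.IH) (rule refl)
  finally show ?case by (simp only: sum.lessThan_Suc add.assoc)
qed simp

lemma indep_Int_nsets: "I \<subseteq> W \<Longrightarrow> indep I (E \<inter> [W]\<^bsup>2\<^esup>) \<longleftrightarrow> indep I E"
  by (auto simp: indep_def subset_iff)

text \<open>Deleting edges does not lower the independence number, so it suffices to bound induced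
  subgraphs.\<close>

lemma hall_ratio_le:
  fixes P :: real
  assumes "simple_graph G" "verts G \<noteq> {}" "0 \<le> P"
    and le: "\<And>S. S \<subseteq> verts G \<Longrightarrow> card S \<le> P * alpha S (edges G)"
  shows "hall_ratio G \<le> P"
proof -
  let ?R = "\<lambda>H. real (card (verts H)) / real (independence_number H)"
  have eq: "{?R H | H. subgraph H G \<and> verts H \<noteq> {}} = ?R ` {H. subgraph H G \<and> verts H \<noteq> {}}"
    by (rule setcompr_eq_image)
  have "?R H \<le> P" if H: "subgraph H G" "verts H \<noteq> {}" for H
  proof -
    have fin: "finite (verts H)" and sub: "verts H \<subseteq> verts G" "edges H \<subseteq> edges G"
      using H(1) by (auto simp: subgraph_def simple_graph_def)
    obtain I where I: "I \<subseteq> verts H" "indep I (edges G)" "card I = alpha (verts H) (edges G)"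
      using independence_number_witness[of "(verts H, edges G)"] fin by auto
    have "indep I (edges H)" using I(2) sub(2) by (auto simp: indep_def)
    then have le': "alpha (verts H) (edges G) \<le> independence_number H"
      using card_le_independence_number[OF fin I(1)] I(3) by simp
    have pos: "0 < real (independence_number H)"
      using le' alpha_pos[OF fin H(2), of "edges G"] by simp
    have "real (card (verts H)) \<le> P * alpha (verts H) (edges G)" by (rule le[OF sub(1)])
    also have "\<dots> \<le> P * independence_number H" using le' assms(3) by (simp add: mult_left_mono)
    finally show ?thesis using pos by (simp add: divide_le_eq)
  qed
  moreover have "finite (?R ` {H. subgraph H G \<and> verts H \<noteq> {}})"
    using finite_subgraphs[OF assms(1)] by simp
  moreover have "subgraph G G" using assms(1) by (simp add: subgraph_def)
  then have "?R ` {H. subgraph H G \<and> verts H \<noteq> {}} \<noteq> {}" using assms(2) by blast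
  ultimately show ?thesis
    unfolding hall_ratio_def eq by (intro Max.boundedI) blast+
qed

theorem theorem3:
  shows "\<exists>P0::real. \<forall>P\<ge>P0. \<exists>G :: nat graph.
    simple_graph G \<and> complete_free 5 G \<and>
    hall_ratio G \<le> P \<and> fractional_chromatic_number G > P\<^sup>2 / 82"
proof (intro exI[of _ "8 :: real"] allI impI)
  fix P :: real
  assume P: "8 \<le> P"
  define a where "a = P / 4 - 1"
  have a: "0 < a" using P by (simp add: a_def)
  obtain VF F z where F: "finite (VF :: nat set)" "locally_sparse 3 VF F"
    and z: "fractional_colouring (VF, F) z" "(\<Sum>I\<in>independent_sets (VF, F). z I) \<le> a + 1"
    and F_ge: "\<And>x. fractional_colouring (VF, F) x \<Longrightarrow> a < (\<Sum>I\<in>independent_sets (VF, F). x I)"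
    using fractionally_critical_graph_exists[of a 3] a by auto
  \<comment> \<open>A graph is fixed for every threshold beforehand, so that the recursion for the
    thresholds can refer to the sizes of these graphs.\<close>
  have "\<forall>N. \<exists>(V :: nat set) E. finite V \<and> a * alpha V E < card V \<and>
    (\<forall>S\<subseteq>V. card S \<le> (a + 1) * alpha S E) \<and> locally_sparse N V E"
    using hall_critical_graph_exists[of a] a by simp
  then obtain VB :: "nat \<Rightarrow> nat set" and EB where B: "\<And>N. finite (VB N)"
    "\<And>N. a * alpha (VB N) (EB N) < card (VB N)"
    "\<And>N S. S \<subseteq> VB N \<Longrightarrow> card S \<le> (a + 1) * alpha S (EB N)"
    "\<And>N. locally_sparse N (VB N) (EB N)"
    by metis
  define N where "N = sparsity_threshold (\<lambda>n. card (VB n))"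
  define V where "V i = VB (N i)" for i
  define E where "E i = EB (N i)" for i
  define W where "W = prod_encode ` Sigma VF V"
  interpret lex_product VF F V E "\<lambda>x. fst (prod_decode x)" "\<lambda>x. snd (prod_decode x)" W
  proof
    have "bij_betw prod_decode W (Sigma VF V)"
      unfolding W_def by (rule bij_betw_byWitness[where f' = prod_encode]) auto
    then show "bij_betw (\<lambda>x. (fst (prod_decode x), snd (prod_decode x))) W (Sigma VF V)" by simp
  qed (use F B in \<open>auto simp: V_def\<close>)
  \<comment> \<open>\<open>EW\<close> may contain singletons and pairs outside \<open>W\<close>.
    Intersecting with the two-element subsets of \<open>W\<close> makes the graph simple and keeps
    the same independent sets inside \<open>W\<close>.\<close>
  define G where "G = (W, EW \<inter> [W]\<^bsup>2\<^esup>)"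
  have G [simp]: "verts G = W" "edges G = EW \<inter> [W]\<^bsup>2\<^esup>" by (simp_all add: G_def)
  have N: "N i = 3 + (\<Sum>j<i. card (V j))" for i
    unfolding V_def N_def by (rule sparsity_threshold_eq)
  have V_ne: "V i \<noteq> {}" for i
  proof
    assume "V i = {}"
    then have "a * alpha (VB (N i)) (EB (N i)) < 0" using B(2)[of "N i"] by (simp add: V_def)
    then show False using a by (simp add: mult_less_0_iff)
  qed
  have "VF \<noteq> {}"
  proof
    assume "VF = {}"
    then have "fractional_colouring (VF, F) (\<lambda>_. 0)" by (simp add: fractional_colouring_def)
    then show False using F_ge a by fastforce
  qed
  then have W_ne: "W \<noteq> {}" using V_ne by (auto simp: W_def)
  have simple: "simple_graph G" using finite_W by (simp add: simple_graph_def)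
  have IS: "independent_sets (S, edges G) = independent_sets (S, EW)" if "S \<subseteq> W" for S
    using that indep_Int_nsets[of _ W EW] by (auto simp: independent_sets_def)
  have "complete_free 5 G"
    unfolding complete_free_def
  proof
    assume "\<exists>K. subgraph K G \<and> complete_graph 5 K"
    then obtain K where K: "subgraph K G" "complete_graph 5 K" by blast
    have KW: "verts K \<subseteq> W" and sub: "edges K \<subseteq> EW"
      using K(1) unfolding subgraph_def G by blast+
    have K5: "card (verts K) = 5" and "clique (verts K) (edges K)"
      using K(2) unfolding complete_graph_def by blast+
    then have "clique (verts K) EW" using sub unfolding clique_def by blast
    moreover have "locally_sparse (N i) (V i) (E i)" for i
      unfolding V_def E_def by (rule B(4))
    moreover have "3 \<le> N i" for i unfolding N by simp
    ultimately have "card (verts K) \<le> 4" using card_clique_le[OF KW _ F(2)] by blast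
    then show False using K5 by simp
  qed
  moreover have "hall_ratio G \<le> P"
  proof (rule hall_ratio_le[OF simple])
    fix S assume S: "S \<subseteq> verts G"
    have "real (card S) \<le> (2 * (a + 1) + 2 * (a + 1)) * alpha S EW"
    proof (rule card_le_alpha[where N = N, OF _ _ _ _ z])
      show "(\<Sum>j | j \<in> VF \<and> j < i. card (V j)) \<le> N i" for i
        unfolding N by (intro trans_le_add2 sum_mono2) auto
    qed (use a B S in \<open>auto simp: V_def E_def\<close>)
    also have "2 * (a + 1) + 2 * (a + 1) = P" by (simp add: a_def)
    also have "alpha S EW = alpha S (edges G)"
      using IS[of S] S by (simp add: independence_number_def)
    finally show "card S \<le> P * alpha S (edges G)" .
  qed (use W_ne P in auto)
  moreover have "P\<^sup>2 / 82 < fractional_chromatic_number G"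
  proof -
    \<comment> \<open>The threshold 8 comes from here: \<open>P / 4 - 1 \<ge> P / 8\<close> holds
      exactly for \<open>P \<ge> 8\<close>. The gap between 64 and 82 makes the final inequality
      strict, although the infimum is only bounded below weakly by \<open>a * a\<close>.\<close>
    have "(P / 8)\<^sup>2 \<le> a\<^sup>2" using P by (intro power_mono) (simp_all add: a_def)
    moreover have "P\<^sup>2 / 82 < (P / 8)\<^sup>2" using P by (simp add: power_divide)
    ultimately have "P\<^sup>2 / 82 < a * a" by (simp add: power2_eq_square)
    also have "a * a \<le> fractional_chromatic_number G"
      unfolding fractional_chromatic_number_def
    proof (rule cInf_greatest)
      show "{\<Sum>I\<in>independent_sets G. x I | x. fractional_colouring G x} \<noteq> {}"
        using fractional_colouring_exists[OF simple] by blast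
      fix s assume "s \<in> {\<Sum>I\<in>independent_sets G. x I | x. fractional_colouring G x}"
      then obtain y where y: "fractional_colouring G y" "s = (\<Sum>I\<in>independent_sets G. y I)" by auto
      have IG: "independent_sets G = independent_sets (W, EW)"
        using IS[of W] by (simp add: G_def)
      have "fractional_colouring (W, EW) y"
        using y(1) by (simp add: fractional_colouring_def IG)
      then show "a * a \<le> s"
        unfolding y(2) IG using a V_ne F_ge B(2)
        by (intro fractional_weight_ge) (auto simp: V_def E_def intro: less_imp_le)
    qed
    finally show ?thesis .
  qed
  ultimately show "\<exists>G :: nat graph. simple_graph G \<and> complete_free 5 G \<and> hall_ratio G \<le> P \<and>
    P\<^sup>2 / 82 < fractional_chromatic_number G"
    using simple by blast
qed

end
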